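(* There exist strong Zygmund lacunary sequences $(\lambda_n)_{n=1}^\infty$ of positive real numbers which grow polynomially, i.e. for which there are constants $C,d>0$ with $\lambda_n\le Cn^d$ for all $n\ge1$. In particular, such sequences cannot be represented as a finite union of Hadamard lacunary sequences.
   Context: Strong Zygmund lacunary: a real sequence $(\lambda_k)_{k=1}^\infty$ is strong Zygmund lacunary if there exist a function $M:\mathbb{N}\to\mathbb{N}$ and a constant $N<\infty$ such that for every $L\in\mathbb{N}=\{1,2,\dots\}$ and all $k\ne l$ with $k,l\ge M(L)$, $$\#\{(k',l'):\ k',l'\ge M(L),\ |\lambda_k-\lambda_l-(\lambda_{k'}-\lambda_{l'})|\le L\}\le N$$ (pairs with $k'=l'$ are included in the count; $N$ does not depend on $L$). Hadamard lacunary: a (finite or infinite) sequence of positive reals $(\mu_k)$ is Hadamard lacunary if there is $q>1$ with $\mu_{k+1}/\mu_k\ge q$ for all $k$. A sequence is a finite union of Hadamard sequences if its set of values is the union of the sets of values of finitely many Hadamard lacunary sequences. *)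

theory Defs
  imports Complex_Main "HOL-Library.Extended_Nat"
begin

text \<open>
  Sequences are indexed by the positive integers; they are represented by functions on
  \<^typ>\<open>nat\<close> whose value at 0 is never used.  Accordingly the threshold function \<open>M\<close> below
  is required to take values in the positive integers.
\<close>

definition strong_zygmund_lacunary :: "(nat \<Rightarrow> real) \<Rightarrow> bool" where
  "strong_zygmund_lacunary x \<longleftrightarrow>
     (\<exists>(M :: nat \<Rightarrow> nat) (N :: nat). \<forall>L \<ge> 1. M L \<ge> 1 \<and>
        (\<forall>k \<ge> M L. \<forall>l \<ge> M L. k \<noteq> l \<longrightarrow>
           (let S = {(k', l'). k' \<ge> M L \<and> l' \<ge> M L \<and>
                       \<bar>x k - x l - (x k' - x l')\<bar> \<le> real L}
            in finite S \<and> card S \<le> N)))"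

definition polynomial_growth :: "(nat \<Rightarrow> real) \<Rightarrow> bool" where
  "polynomial_growth x \<longleftrightarrow>
     (\<exists>C > 0. \<exists>d > 0. \<forall>n \<ge> 1. x n \<le> C * real n powr d)"

text \<open>
  A finite or infinite sequence is a pair of a length \<open>K\<close> (possibly infinite) and a function,
  of which only the values at indices \<open>k\<close> with \<open>1 \<le> k \<le> K\<close> matter.
\<close>

definition seq_indices :: "enat \<Rightarrow> nat set" where
  "seq_indices K = {k. 1 \<le> k \<and> enat k \<le> K}"

definition hadamard_lacunary :: "enat \<Rightarrow> (nat \<Rightarrow> real) \<Rightarrow> bool" where
  "hadamard_lacunary K \<mu> \<longleftrightarrow>
     (\<forall>k \<in> seq_indices K. \<mu> k > 0) \<and>
     (\<exists>q > 1. \<forall>k. k \<in> seq_indices K \<and> Suc k \<in> seq_indices K \<longrightarrow> \<mu> (Suc k) / \<mu> k \<ge> q)"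

definition finite_union_of_hadamard :: "(nat \<Rightarrow> real) \<Rightarrow> bool" where
  "finite_union_of_hadamard x \<longleftrightarrow>
     (\<exists>(m :: nat) (K :: nat \<Rightarrow> enat) (\<mu> :: nat \<Rightarrow> nat \<Rightarrow> real).
        (\<forall>i < m. hadamard_lacunary (K i) (\<mu> i)) \<and>
        x ` {1..} = (\<Union>i<m. \<mu> i ` seq_indices (K i)))"

end

theory Submission
  imports Defs "HOL-Analysis.Infinite_Sum" "HOL-Analysis.Summation_Tests"
begin

text \<open>
  Existence is a greedy choice: at stage \<open>n\<close> there are at most \<open>n ^ 3\<close> numbers of the form
  \<open>x a + x b - x c\<close> and \<open>(x a + x b) / 2\<close> with \<open>a, b, c < n\<close>, and avoiding their
  \<open>n\<close>-neighbourhoods leaves an admissible integer of size \<open>O(n ^ 4)\<close>.  Looking at the largest of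
  four indices, one sees that the resulting sequence has \<open>M L = L\<close> and \<open>N = 1\<close>.
  For the second part, a Hadamard lacunary set satisfies \<open>\<Sum> v powr -s < \<infinity>\<close> for every
  \<open>s > 0\<close>, whereas an eventually injective sequence with \<open>x n \<le> C * n powr d\<close> violates this for
  \<open>s = 1 / d\<close> by comparison with the harmonic series.
\<close>

section \<open>Greedy construction of a widely spread integer sequence\<close>

text \<open>The two families serve the two ways in which the largest of four indices can occur:
  once, or twice with the same sign. The range for \<open>y\<close> holds one integer more than the
  bound on the number of forbidden ones, so a choice always remains.\<close>

definition spread_step :: "(nat \<Rightarrow> int) \<Rightarrow> nat \<Rightarrow> int \<Rightarrow> bool" where
  "spread_step f n y \<longleftrightarrow> 1 \<le> y \<and> y \<le> 2 * int n ^ 3 * (2 * int n + 1) + 1 \<and>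
     (\<forall>a<n. \<forall>b<n. \<forall>c<n. \<bar>y - (f a + f b - f c)\<bar> > int n) \<and>
     (\<forall>a<n. \<forall>b<n. \<bar>2 * y - (f a + f b)\<bar> > int n)"

lemma spread_step_exists: "\<exists>y. spread_step f n y"
proof -
  \<comment> \<open>The coordinate \<open>t\<close> runs through the \<open>2 * n + 1\<close>
    offsets of a window. Letting \<open>h\<close> ignore its third index gives both families the
    same parameter set, hence the same count.\<close>
  define T where "T = {..<n} \<times> {..<n} \<times> {..<n} \<times> {- int n..int n}"
  define g where "g = (\<lambda>(a, b, c, t). f a + f b - f c + t)"
  define h where "h = (\<lambda>(a :: nat, b :: nat, c :: nat, t). (f a + f b) div 2 + t)"
  have finT: "finite T" by (simp add: T_def)
  have "card T = n * (n * (n * nat (1 + int n * 2)))"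
    by (simp add: T_def card_cartesian_product algebra_simps)
  moreover have "nat (1 + int n * 2) = 2 * n + 1" by linarith
  ultimately have "card T = n ^ 3 * (2 * n + 1)"
    by (simp only: power3_eq_cube mult.assoc)
  then have "card (g ` T \<union> h ` T) \<le> 2 * n ^ 3 * (2 * n + 1)"
    using card_Un_le[of "g ` T" "h ` T"] card_image_le[OF finT, of g] card_image_le[OF finT, of h]
    by simp
  also have "\<dots> < card {1..2 * int n ^ 3 * (2 * int n + 1) + 1}"
  proof -
    have "2 * int n ^ 3 * (2 * int n + 1) + 1 = int (2 * n ^ 3 * (2 * n + 1) + 1)"
      by (simp only: of_nat_simps of_nat_power of_nat_numeral)
    then show ?thesis by (simp only: card_atLeastAtMost_int)
  qed
  finally have "\<not> {1..2 * int n ^ 3 * (2 * int n + 1) + 1} \<subseteq> g ` T \<union> h ` T"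
    using card_mono[of "g ` T \<union> h ` T"] finT by (meson finite_UnI finite_imageI leD)
  then obtain y where y: "y \<in> {1..2 * int n ^ 3 * (2 * int n + 1) + 1}"
    and yg: "y \<notin> g ` T" and yh: "y \<notin> h ` T" by blast
  have "\<bar>y - (f a + f b - f c)\<bar> > int n" if "a < n" "b < n" "c < n" for a b c
  proof (rule ccontr)
    assume "\<not> ?thesis"
    then have "(a, b, c, y - (f a + f b - f c)) \<in> T" using that by (auto simp: T_def)
    from imageI[OF this, of g] show False using yg by (simp add: g_def)
  qed
  moreover have "\<bar>2 * y - (f a + f b)\<bar> > int n" if "a < n" "b < n" for a b
  proof (rule ccontr)
    assume "\<not> ?thesis"
    \<comment> \<open>Rounding in \<open>div\<close> costs at most 1/2, so the distance is at most
      \<open>(n + 1) / 2\<close>. This is at most \<open>n\<close> because \<open>a < n\<close>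
      forces \<open>n \<ge> 1\<close>.\<close>
    then have "\<bar>y - (f a + f b) div 2\<bar> \<le> int n" using that(1) by linarith
    then have "(a, b, a, y - (f a + f b) div 2) \<in> T" using that by (auto simp: T_def)
    from imageI[OF this, of h] show False using yh by (simp add: h_def)
  qed
  ultimately show ?thesis using y by (auto simp: spread_step_def)
qed

text \<open>The condition at stage \<open>n\<close> reads \<open>f\<close> only below
  \<open>n\<close>, so the choices can be made by well-founded recursion.\<close>

lemma spread_sequence_exists: "\<exists>f. \<forall>n. spread_step f n (f n)"
proof (rule dependent_wf_choice[OF wf_less])
  show "spread_step f n r = spread_step g n r"
    if "\<And>z. (z, n) \<in> {(x, y). x < y} \<Longrightarrow> f z = g z" for f g n r
    using that by (auto simp: spread_step_def)
qed (rule spread_step_exists)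

section \<open>Separation of two-term and four-term combinations\<close>

text \<open>Three equal indices in the first family collapse \<open>f a + f b - f c\<close> to
  \<open>f a\<close>; the gap then exceeds the larger index, which is at least
  \<open>L\<close>.\<close>

lemma spread_two_apart:
  assumes f: "\<And>n. spread_step f n (f n)" and "i \<noteq> j" "L \<le> i" "L \<le> j"
  shows "\<bar>f i - f j\<bar> > int L"
proof -
  have *: "\<bar>f n - f a\<bar> > int n" if "a < n" for n a
  proof -
    have "\<bar>f n - (f a + f a - f a)\<bar> > int n"
      using f[of n] that unfolding spread_step_def by blast
    then show ?thesis by simp
  qed
  consider "j < i" | "i < j" using \<open>i \<noteq> j\<close> by linarith
  then show ?thesis
  proof cases
    case 1
    then show ?thesis using *[OF 1] \<open>L \<le> i\<close> by linarith
  next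
    case 2
    then show ?thesis using *[OF 2] \<open>L \<le> j\<close> by linarith
  qed
qed

text \<open>Since no index occurs on both sides, the largest one stands on one side only. If it
  occurs once there, the first family applies; if both entries of that side attain it, the second
  does.\<close>

lemma spread_four_apart:
  assumes f: "\<And>n. spread_step f n (f n)"
    and ne: "a \<noteq> c" "a \<noteq> d" "b \<noteq> c" "b \<noteq> d"
    and ge: "L \<le> a" "L \<le> b" "L \<le> c" "L \<le> d"
  shows "\<bar>f a + f b - (f c + f d)\<bar> > int L"
proof -
  have one: "\<bar>f n - (f p + f q - f r)\<bar> > int n" if "p < n" "q < n" "r < n" for n p q r
    using f[of n] that unfolding spread_step_def by blast
  have two: "\<bar>2 * f n - (f p + f q)\<bar> > int n" if "p < n" "q < n" for n p q
    using f[of n] that unfolding spread_step_def by blast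
  have main: "\<bar>f a + f b - (f c + f d)\<bar> > int L"
    if "c < a" "d < a" "b \<le> a" "L \<le> a" for a b c d
  proof (cases "b = a")
    case True
    then show ?thesis using two[of c a d] that by simp
  next
    case False
    then show ?thesis using one[of c a d b] that by simp
  qed
  obtain p where p: "p \<in> {a, b, c, d}" "a \<le> p" "b \<le> p" "c \<le> p" "d \<le> p"
    using Max_in[of "{a, b, c, d}"] Max_ge[of "{a, b, c, d}"]
    by (metis finite.intros insertCI insert_not_empty)
  then consider "p = a" | "p = b" | "p = c" | "p = d" by blast
  then consider "c < a" "d < a" "b \<le> a" | "c < b" "d < b" "a \<le> b"
    | "a < c" "b < c" "d \<le> c" | "a < d" "b < d" "c \<le> d"
    using p(2-5) ne by cases (simp_all add: le_less)
  then show ?thesis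
  proof cases
    case 1
    then show ?thesis using main[OF 1 ge(1)] by simp
  next
    case 2
    then show ?thesis using main[OF 2 ge(2)] by (simp add: add.commute)
  next
    case 3
    have "\<bar>f c + f d - (f a + f b)\<bar> > int L" using main[OF 3 ge(3)] .
    then show ?thesis by linarith
  next
    case 4
    have "\<bar>f d + f c - (f a + f b)\<bar> > int L" using main[OF 4 ge(4)] .
    then show ?thesis by linarith
  qed
qed

lemma strong_zygmund_lacunary_spread:
  assumes f: "\<And>n. spread_step f n (f n)"
  shows "strong_zygmund_lacunary (\<lambda>n. real_of_int (f n))"
  unfolding strong_zygmund_lacunary_def
proof (intro exI allI impI conjI)
  fix L k l :: nat
  assume kl: "k \<ge> L" "l \<ge> L" "k \<noteq> l"
  let ?S = "{(k', l'). k' \<ge> L \<and> l' \<ge> L \<and>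
    \<bar>real_of_int (f k) - real_of_int (f l) - (real_of_int (f k') - real_of_int (f l'))\<bar> \<le> real L}"
  have "(k', l') = (k, l)" if "(k', l') \<in> ?S" for k' l'
  proof -
    have ge: "k' \<ge> L" "l' \<ge> L"
      and "\<bar>real_of_int (f k) - real_of_int (f l) - (real_of_int (f k') - real_of_int (f l'))\<bar> \<le> real L"
      using that by auto
    then have le: "\<bar>f k - f l - (f k' - f l')\<bar> \<le> int L" by linarith
    \<comment> \<open>In each of these three degenerate cases the inequality compares just two
      values of \<open>f\<close>.\<close>
    have "k' \<noteq> l'"
      using spread_two_apart[OF f kl(3,1,2)] le by auto
    moreover have "l = l'" if "k = k'"
      using spread_two_apart[OF f, of l l' L] kl(2) ge(2) le that by (cases "l = l'") auto
    moreover have "k = k'" if "l = l'"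
      using spread_two_apart[OF f, of k k' L] kl(1) ge(1) le that by (cases "k = k'") auto
    \<comment> \<open>Otherwise \<open>{k, l'}\<close> and \<open>{l, k'}\<close> are disjoint, and
      regrouping the difference of differences as a comparison of two sums contradicts the four-term
      separation.\<close>
    moreover have "k = k' \<or> l' = l"
    proof (rule ccontr)
      assume "\<not> ?thesis"
      then have "\<bar>f k + f l' - (f l + f k')\<bar> > int L"
        using spread_four_apart[OF f, of k l k' l' L] kl ge \<open>k' \<noteq> l'\<close> by simp
      then show False using le by linarith
    qed
    ultimately show ?thesis using kl by auto
  qed
  then have "?S \<subseteq> {(k, l)}" by auto
  then show "let S = ?S in finite S \<and> card S \<le> 1"
    using card_mono[OF _ \<open>?S \<subseteq> {(k, l)}\<close>] finite_subset[OF \<open>?S \<subseteq> {(k, l)}\<close>]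
    by (simp only: Let_def finite.intros card.insert) simp
qed simp

lemma polynomial_growth_spread:
  assumes f: "\<And>n. spread_step f n (f n)"
  shows "polynomial_growth (\<lambda>n. real_of_int (f n))"
  unfolding polynomial_growth_def
proof (intro exI conjI allI impI)
  fix n :: nat
  assume n: "n \<ge> 1"
  have "real n ^ 3 \<le> real n ^ 4" "1 \<le> real n ^ 4"
    using n by (auto intro: power_increasing)
  moreover have "real_of_int (f n) \<le> real_of_int (2 * int n ^ 3 * (2 * int n + 1) + 1)"
    using f[of n] unfolding spread_step_def of_int_le_iff by blast
  moreover have "real n ^ 4 = real n ^ 3 * real n" by (simp add: eval_nat_numeral)
  \<comment> \<open>The constant is \<open>4 + 2 + 1\<close>: expand the bound and replace each
    power of \<open>n\<close> by \<open>n ^ 4\<close>.\<close>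
  ultimately have "real_of_int (f n) \<le> 7 * real n ^ 4" by (simp add: algebra_simps)
  also have "real n ^ 4 = real n powr 4" using n by simp
  finally show "real_of_int (f n) \<le> 7 * real n powr 4" .
qed auto

section \<open>Summability of negative powers over Hadamard lacunary sets\<close>

lemma hadamard_lacunary_geometric:
  assumes "hadamard_lacunary K \<mu>"
  obtains q where "q > 1" "\<And>k. Suc k \<in> seq_indices K \<Longrightarrow> \<mu> (Suc k) \<ge> \<mu> 1 * q ^ k"
proof -
  from assms obtain q where q: "q > 1" and pos: "\<And>k. k \<in> seq_indices K \<Longrightarrow> \<mu> k > 0"
    and ratio: "\<And>k. k \<in> seq_indices K \<Longrightarrow> Suc k \<in> seq_indices K \<Longrightarrow> \<mu> (Suc k) / \<mu> k \<ge> q"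
    unfolding hadamard_lacunary_def by blast
  have "\<mu> (Suc k) \<ge> \<mu> 1 * q ^ k" if "Suc k \<in> seq_indices K" for k
    using that
  proof (induction k)
    case (Suc k)
    have I: "Suc k \<in> seq_indices K"
      using Suc.prems by (cases K) (auto simp: seq_indices_def)
    have "\<mu> 1 * q ^ Suc k \<le> \<mu> (Suc k) * q"
      using Suc.IH[OF I] q by simp
    also have "\<dots> \<le> \<mu> (Suc (Suc k))"
      using ratio[OF I Suc.prems] pos[OF I] by (simp add: field_simps)
    finally show ?case .
  qed simp
  then show ?thesis using that q by blast
qed

text \<open>A geometric series with ratio \<open>q powr - s\<close> dominates. Summing over the set
  of values, not over indices, lets finite unions be treated regardless of overlaps.\<close>

lemma hadamard_lacunary_summable:
  assumes "hadamard_lacunary K \<mu>" "s > 0"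
  shows "(\<lambda>v. v powr - s) summable_on (\<mu> ` seq_indices K)"
proof (cases "seq_indices K = {}")
  case False
  then have one: "1 \<in> seq_indices K"
    by (cases K) (auto simp: seq_indices_def)
  from assms(1) obtain q where q: "q > 1"
    and geo: "\<And>k. Suc k \<in> seq_indices K \<Longrightarrow> \<mu> (Suc k) \<ge> \<mu> 1 * q ^ k"
    by (rule hadamard_lacunary_geometric) blast
  have \<mu>1: "\<mu> 1 > 0" using assms(1) one by (auto simp: hadamard_lacunary_def)
  define r where "r = q powr - s"
  have r: "0 < r" "r < 1" using q assms(2) by (auto simp: r_def powr_less_one)
  have "summable (\<lambda>k. norm (\<mu> 1 powr - s * r ^ k))"
    using r by (simp add: norm_mult norm_power summable_mult)
  then have "(\<lambda>k. \<mu> 1 powr - s * r ^ k) summable_on UNIV"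
    by (rule norm_summable_imp_summable_on)
  then have "(\<lambda>k. \<mu> 1 powr - s * r ^ k) summable_on {k. Suc k \<in> seq_indices K}"
    by (rule summable_on_subset_banach) simp
  then have "(\<lambda>k. \<mu> (Suc k) powr - s) summable_on {k. Suc k \<in> seq_indices K}"
  proof (rule summable_on_comparison_test)
    fix k
    assume "k \<in> {k. Suc k \<in> seq_indices K}"
    then have "\<mu> (Suc k) powr - s \<le> (\<mu> 1 * q ^ k) powr - s"
      using geo[of k] \<mu>1 q assms(2) by (intro powr_mono2') auto
    also have "\<dots> = \<mu> 1 powr - s * r ^ k"
      using \<mu>1 q by (simp add: powr_mult r_def powr_power powr_powr mult.commute flip: powr_realpow)
    finally show "\<mu> (Suc k) powr - s \<le> \<mu> 1 powr - s * r ^ k" .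
  qed simp
  moreover have "seq_indices K = Suc ` {k. Suc k \<in> seq_indices K}"
    by (auto simp: seq_indices_def image_iff intro: exI[of _ "x - 1" for x])
      (metis Suc_le_D)
  ultimately have sum: "(\<lambda>k. \<mu> k powr - s) summable_on seq_indices K"
    using summable_on_reindex[of Suc "{k. Suc k \<in> seq_indices K}" "\<lambda>k. \<mu> k powr - s"]
    by (simp add: o_def)
  \<comment> \<open>\<open>J\<close> selects one index per value, which carries summability from
    indices to values.\<close>
  obtain J where J: "J \<subseteq> seq_indices K" "inj_on \<mu> J" "\<mu> ` seq_indices K = \<mu> ` J"
    using subset_image_inj[of "\<mu> ` seq_indices K" \<mu> "seq_indices K"] by auto
  have "(\<lambda>k. \<mu> k powr - s) summable_on J"
    by (rule summable_on_subset_banach[OF sum J(1)])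
  then show ?thesis
    using J by (simp add: summable_on_reindex o_def)
qed simp

section \<open>Eventual injectivity and divergence under polynomial growth\<close>

text \<open>
  The diagonal pairs \<open>(k', k')\<close> all have difference 0, so the finiteness of the count forces
  \<open>x k \<noteq> x l\<close>.
\<close>

lemma strong_zygmund_lacunary_inj:
  assumes "strong_zygmund_lacunary x"
  obtains m where "m \<ge> 1" "inj_on x {m..}"
proof -
  from assms obtain M N where M: "\<forall>L \<ge> 1. M L \<ge> (1 :: nat) \<and>
      (\<forall>k \<ge> M L. \<forall>l \<ge> M L. k \<noteq> l \<longrightarrow>
        (let S = {(k', l'). k' \<ge> M L \<and> l' \<ge> M L \<and> \<bar>x k - x l - (x k' - x l')\<bar> \<le> real L}
         in finite S \<and> card S \<le> N))"
    unfolding strong_zygmund_lacunary_def by blast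
  have "inj_on x {M 1..}"
  proof (rule inj_onI, rule ccontr)
    fix k l
    assume kl: "k \<in> {M 1..}" "l \<in> {M 1..}" "x k = x l" "k \<noteq> l"
    let ?S = "{(k', l'). k' \<ge> M 1 \<and> l' \<ge> M 1 \<and> \<bar>x k - x l - (x k' - x l')\<bar> \<le> real 1}"
    have "let S = ?S in finite S \<and> card S \<le> N"
      by (rule conjunct2[OF M[rule_format, OF order_refl], rule_format]) (use kl in simp_all)
    then have "finite ?S" by (simp only: Let_def)
    moreover have "(\<lambda>j. (j, j)) ` {M 1..} \<subseteq> ?S" using kl(3) by auto
    ultimately have "finite ((\<lambda>j. (j, j)) ` {M 1..})" by (rule rev_finite_subset)
    then have "finite {M 1..}" by (rule finite_imageD) (auto simp: inj_on_def)
    then show False by (simp add: infinite_Ici)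
  qed
  moreover have "M 1 \<ge> 1" using M by simp
  ultimately show ?thesis using that by blast
qed

text \<open>The exponent \<open>- (1 / d)\<close> reverses the growth bound and turns it into a
  constant times \<open>1 / n\<close>, so the harmonic series is a minorant.\<close>

lemma not_summable_on_powr_polynomial_growth:
  assumes pos: "\<And>n. n \<ge> m \<Longrightarrow> x n > 0" and "m \<ge> 1" "C > 0" "d > 0"
    and bound: "\<And>n. n \<ge> m \<Longrightarrow> x n \<le> C * real n powr d"
  shows "\<not> (\<lambda>n. x n powr - (1 / d)) summable_on {m..}"
proof
  assume "(\<lambda>n. x n powr - (1 / d)) summable_on {m..}"
  then have "(\<lambda>n. C powr - (1 / d) * inverse (real n)) summable_on {m..}"
  proof (rule summable_on_comparison_test)
    fix n
    assume n: "n \<in> {m..}"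
    have "C powr - (1 / d) * inverse (real n) = (C * real n powr d) powr - (1 / d)"
      using assms(2-4) n by (simp add: powr_mult powr_powr powr_minus)
    also have "\<dots> \<le> x n powr - (1 / d)"
      using n pos[of n] bound[of n] assms(4) by (intro powr_mono2') auto
    finally show "C powr - (1 / d) * inverse (real n) \<le> x n powr - (1 / d)" .
  qed (use assms(3) in auto)
  then have "(\<lambda>n. inverse (real n)) summable_on {m..}"
    using assms(3) by (subst (asm) summable_on_cmult_right') auto
  \<comment> \<open>Only finitely many terms are added; the one at index 0 is
    \<open>inverse 0 = 0\<close>.\<close>
  then have "(\<lambda>n. inverse (real n)) summable_on ({..<m} \<union> {m..})"
    by (intro summable_on_Un_disjoint) auto
  moreover have "{..<m} \<union> {m..} = UNIV" by auto
  ultimately have "(\<lambda>n. inverse (real n)) summable_on UNIV" by simp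
  then have "summable (\<lambda>n. inverse (real n))" by (rule summable_on_imp_summable)
  then show False using not_summable_harmonic[where 'a = real] by simp
qed

lemma polynomial_growth_not_finite_union_of_hadamard:
  assumes pos: "\<forall>n\<ge>1. x n > 0" and "m \<ge> 1" and inj: "inj_on x {m..}"
    and "polynomial_growth x"
  shows "\<not> finite_union_of_hadamard x"
proof
  assume "finite_union_of_hadamard x"
  then obtain p :: nat and K \<mu> where H: "\<And>i. i < p \<Longrightarrow> hadamard_lacunary (K i) (\<mu> i)"
    and img: "x ` {1..} = (\<Union>i<p. \<mu> i ` seq_indices (K i))"
    unfolding finite_union_of_hadamard_def by blast
  from assms(4) obtain C d where Cd: "C > 0" "d > 0" "\<And>n. n \<ge> 1 \<Longrightarrow> x n \<le> C * real n powr d"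
    unfolding polynomial_growth_def by blast
  have "(\<lambda>v. v powr - (1 / d)) summable_on (\<Union>i<j. \<mu> i ` seq_indices (K i))" if "j \<le> p" for j
    using that
  proof (induction j)
    case (Suc j)
    then show ?case
      using hadamard_lacunary_summable[OF H[of j], of "1 / d"] Cd(2)
      by (simp add: lessThan_Suc summable_on_union)
  qed simp
  then have "(\<lambda>v. v powr - (1 / d)) summable_on x ` {1..}" unfolding img by blast
  then have "(\<lambda>v. v powr - (1 / d)) summable_on x ` {m..}"
    by (rule summable_on_subset_banach) (use assms(2) in auto)
  \<comment> \<open>Injectivity on the tail turns the sum over values into a sum over indices, where
    repeated values would count separately.\<close>
  then have "(\<lambda>n. x n powr - (1 / d)) summable_on {m..}"
    using inj by (simp add: summable_on_reindex o_def)
  then show False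
    using not_summable_on_powr_polynomial_growth[of m x C d] pos Cd assms(2) by auto
qed

theorem proposition3p3:
  "(\<exists>x :: nat \<Rightarrow> real. (\<forall>n \<ge> 1. x n > 0) \<and> strong_zygmund_lacunary x \<and> polynomial_growth x) \<and>
   (\<forall>x :: nat \<Rightarrow> real. (\<forall>n \<ge> 1. x n > 0) \<and> strong_zygmund_lacunary x \<and> polynomial_growth x
      \<longrightarrow> \<not> finite_union_of_hadamard x)"
proof (intro conjI allI impI)
  obtain f where f: "\<And>n. spread_step f n (f n)"
    using spread_sequence_exists by blast
  have "0 < f n" for n using f[of n] by (simp add: spread_step_def)
  then show "\<exists>x :: nat \<Rightarrow> real.
      (\<forall>n \<ge> 1. x n > 0) \<and> strong_zygmund_lacunary x \<and> polynomial_growth x"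
    using strong_zygmund_lacunary_spread[OF f] polynomial_growth_spread[OF f]
    by (intro exI[of _ "\<lambda>n. real_of_int (f n)"]) simp
next
  fix x :: "nat \<Rightarrow> real"
  assume x: "(\<forall>n \<ge> 1. x n > 0) \<and> strong_zygmund_lacunary x \<and> polynomial_growth x"
  \<comment> \<open>Lacunarity enters the second claim through this injectivity alone; the rest is
    growth.\<close>
  then obtain m where "m \<ge> 1" "inj_on x {m..}"
    using strong_zygmund_lacunary_inj by blast
  then show "\<not> finite_union_of_hadamard x"
    using polynomial_growth_not_finite_union_of_hadamard[of x m] x by simp
qed

end
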